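(* Let $H$ be a Hilbert holomorphic function space on $\mathbb{D}$ such that $H$ contains the polynomials, the polynomials are dense in $H$, and the odd polynomials are not dense in the set of odd functions in $H$ (with respect to the norm of $H$). Then there exists $f\in H$ lying outside the closed linear span in $H$ of $\{s_n(f): n\ge 0\}$. Hence, for this $f$, there is no sequence of linear maps $T_n:H\to H$ of the form \[ T_n(g)=\sum_{k=0}^n c_{nk}\,s_k(g)\qquad(g\in H), \] where $(c_{nk})_{0\le k\le n<\infty}$ is a triangular array of complex numbers, such that $\|T_n(f)-f\|_H\to 0$ as $n\to\infty$.
   Context: $\mathbb{D}$ denotes the open unit disk in $\mathbb{C}$, and $\mathrm{Hol}(\mathbb{D})$ the Fréchet space of holomorphic functions on $\mathbb{D}$ with the topology of uniform convergence on compact sets. A Hilbert holomorphic function space on $\mathbb{D}$ is a (complex) Hilbert space $H$ that is a subset (linear subspace) of $\mathrm{Hol}(\mathbb{D})$ such that the inclusion map $H\hookrightarrow\mathrm{Hol}(\mathbb{D})$ is continuous. A function $f$ on $\mathbb{D}$ is odd if $f(-z)=-f(z)$ for all $z\in\mathbb{D}$. For $f\in\mathrm{Hol}(\mathbb{D})$ with Taylor expansion $f(z)=\sum_{j\ge 0}\widehat{f}(j)z^j$, $s_n(f)(z):=\sum_{j=0}^n\widehat{f}(j)z^j$ denotes the $n$-th Taylor partial sum. *)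

theory Defs
  imports
    "HOL-Complex_Analysis.Complex_Analysis"
    "HOL-Library.Function_Algebras"
begin

text \<open>
  A function on the open unit disc is represented by its extension by zero to a function on the
  whole complex plane, so that equality of functions on the disc is HOL equality. Addition,
  subtraction and zero on functions are the pointwise operations.
\<close>

definition disc_ext :: "(complex \<Rightarrow> complex) \<Rightarrow> (complex \<Rightarrow> complex)" where
  "disc_ext f = (\<lambda>z. if z \<in> ball 0 1 then f z else 0)"

definition hol_disc :: "(complex \<Rightarrow> complex) set" where
  "hol_disc = {f. f holomorphic_on ball 0 1 \<and> (\<forall>z. z \<notin> ball 0 1 \<longrightarrow> f z = 0)}"

definition fscale :: "complex \<Rightarrow> (complex \<Rightarrow> complex) \<Rightarrow> (complex \<Rightarrow> complex)" where
  "fscale c f = (\<lambda>z. c * f z)"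

interpretation cfun: vector_space fscale
  by standard (auto simp: fscale_def fun_eq_iff algebra_simps)

text \<open>The topology of uniform convergence on compact subsets of the disc.\<close>

definition open_hol_disc :: "(complex \<Rightarrow> complex) set \<Rightarrow> bool" where
  "open_hol_disc U \<longleftrightarrow> U \<subseteq> hol_disc \<and>
     (\<forall>f\<in>U. \<exists>K e. compact K \<and> K \<subseteq> ball 0 1 \<and> e > 0 \<and>
        {g \<in> hol_disc. \<forall>z\<in>K. dist (g z) (f z) < e} \<subseteq> U)"

definition hol_disc_topology :: "(complex \<Rightarrow> complex) topology" where
  "hol_disc_topology = topology open_hol_disc"

lemma istopology_open_hol_disc: "istopology open_hol_disc"
  unfolding istopology_def
proof (intro conjI allI impI)
  fix S T assume S: "open_hol_disc S" and T: "open_hol_disc T"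
  show "open_hol_disc (S \<inter> T)"
    unfolding open_hol_disc_def
  proof (intro conjI ballI)
    show "S \<inter> T \<subseteq> hol_disc" using S by (auto simp: open_hol_disc_def)
    fix f assume f: "f \<in> S \<inter> T"
    obtain K e where K: "compact K" "K \<subseteq> ball 0 1" "e > 0"
      "{g \<in> hol_disc. \<forall>z\<in>K. dist (g z) (f z) < e} \<subseteq> S"
      using S f unfolding open_hol_disc_def by blast
    obtain L d where L: "compact L" "L \<subseteq> ball 0 1" "d > 0"
      "{g \<in> hol_disc. \<forall>z\<in>L. dist (g z) (f z) < d} \<subseteq> T"
      using T f unfolding open_hol_disc_def by blast
    show "\<exists>K e. compact K \<and> K \<subseteq> ball 0 1 \<and> e > 0 \<and>
        {g \<in> hol_disc. \<forall>z\<in>K. dist (g z) (f z) < e} \<subseteq> S \<inter> T"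
    proof (intro exI conjI)
      show "compact (K \<union> L)" using K(1) L(1) by (rule compact_Un)
      show "K \<union> L \<subseteq> ball 0 1" using K(2) L(2) by (rule Un_least)
      show "min e d > 0" using K(3) L(3) by simp
      show "{g \<in> hol_disc. \<forall>z\<in>K \<union> L. dist (g z) (f z) < min e d} \<subseteq> S \<inter> T"
      proof
        fix g assume g: "g \<in> {g \<in> hol_disc. \<forall>z\<in>K \<union> L. dist (g z) (f z) < min e d}"
        have "g \<in> S" by (rule subsetD[OF K(4)]) (use g in simp)
        moreover have "g \<in> T" by (rule subsetD[OF L(4)]) (use g in simp)
        ultimately show "g \<in> S \<inter> T" ..
      qed
    qed
  qed
next
  fix \<K> assume *: "\<forall>U\<in>\<K>. open_hol_disc U"
  show "open_hol_disc (\<Union>\<K>)"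
    unfolding open_hol_disc_def
  proof (intro conjI ballI)
    show "\<Union>\<K> \<subseteq> hol_disc" using * by (auto simp: open_hol_disc_def)
    fix f assume "f \<in> \<Union>\<K>"
    then obtain U where U: "U \<in> \<K>" "f \<in> U" by blast
    then have "\<exists>K e. compact K \<and> K \<subseteq> ball 0 1 \<and> e > 0 \<and>
        {g \<in> hol_disc. \<forall>z\<in>K. dist (g z) (f z) < e} \<subseteq> U"
      using * unfolding open_hol_disc_def by blast
    then obtain K e where K: "compact K" "K \<subseteq> ball 0 1" "e > 0"
      "{g \<in> hol_disc. \<forall>z\<in>K. dist (g z) (f z) < e} \<subseteq> U"
      by blast
    show "\<exists>K e. compact K \<and> K \<subseteq> ball 0 1 \<and> e > 0 \<and>
        {g \<in> hol_disc. \<forall>z\<in>K. dist (g z) (f z) < e} \<subseteq> \<Union>\<K>"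
      using K(1-3) order_trans[OF K(4) Union_upper[OF U(1)]] by (intro exI conjI)
  qed
qed

lemma openin_hol_disc_topology: "openin hol_disc_topology = open_hol_disc"
  by (simp add: hol_disc_topology_def istopology_open_hol_disc topology_inverse')

lemma topspace_hol_disc_topology [simp]: "topspace hol_disc_topology = hol_disc"
proof -
  have "open_hol_disc hol_disc"
    unfolding open_hol_disc_def
    by (intro conjI ballI subset_refl exI[of _ "{}"] exI[of _ "1::real"]) auto
  moreover have "U \<subseteq> hol_disc" if "open_hol_disc U" for U
    using that by (simp add: open_hol_disc_def)
  ultimately show ?thesis
    unfolding topspace_def openin_hol_disc_topology by blast
qed

text \<open>
  The library metric spaces require a distance that is nonnegative and symmetric off the carrier
  as well, hence the default value 0 there.
\<close>

definition ip_norm :: "('a \<Rightarrow> 'a \<Rightarrow> complex) \<Rightarrow> 'a \<Rightarrow> real" where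
  "ip_norm ip f = sqrt (Re (ip f f))"

definition ip_dist :: "'a::minus set \<Rightarrow> ('a \<Rightarrow> 'a \<Rightarrow> complex) \<Rightarrow> 'a \<Rightarrow> 'a \<Rightarrow> real" where
  "ip_dist H ip f g = (if f \<in> H \<and> g \<in> H then ip_norm ip (f - g) else 0)"

abbreviation ip_topology :: "'a::minus set \<Rightarrow> ('a \<Rightarrow> 'a \<Rightarrow> complex) \<Rightarrow> 'a topology" where
  "ip_topology H ip \<equiv> Metric_space.mtopology H (ip_dist H ip)"

text \<open>
  An inner product (linear in the first argument) on a space of complex functions. Only its values
  on the carrier matter.
\<close>

locale inner_product_function_space =
  fixes H :: "(complex \<Rightarrow> complex) set"
    and ip :: "(complex \<Rightarrow> complex) \<Rightarrow> (complex \<Rightarrow> complex) \<Rightarrow> complex"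
  assumes subspace: "cfun.subspace H"
    and ip_add: "\<lbrakk>f \<in> H; g \<in> H; h \<in> H\<rbrakk> \<Longrightarrow> ip (f + g) h = ip f h + ip g h"
    and ip_scale: "\<lbrakk>f \<in> H; g \<in> H\<rbrakk> \<Longrightarrow> ip (fscale c f) g = c * ip f g"
    and ip_cnj: "\<lbrakk>f \<in> H; g \<in> H\<rbrakk> \<Longrightarrow> ip g f = cnj (ip f g)"
    and ip_nonneg: "f \<in> H \<Longrightarrow> 0 \<le> Re (ip f f)"
    and ip_definite: "f \<in> H \<Longrightarrow> ip f f = 0 \<Longrightarrow> f = 0"
begin

lemma ip_self: "f \<in> H \<Longrightarrow> ip f f = of_real (Re (ip f f))"
proof -
  assume "f \<in> H"
  then have "ip f f \<in> \<real>" using ip_cnj[of f f] Reals_cnj_iff[of "ip f f"] by metis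
  then show ?thesis by (rule of_real_Re[symmetric])
qed

lemma ip_norm_nonneg: "f \<in> H \<Longrightarrow> 0 \<le> ip_norm ip f"
  using ip_nonneg by (simp add: ip_norm_def)

lemma ip_add_right:
  assumes "f \<in> H" "g \<in> H" "h \<in> H" shows "ip h (f + g) = ip h f + ip h g"
proof -
  have fg: "f + g \<in> H" using assms cfun.subspace_add[OF subspace] by blast
  show ?thesis
    unfolding ip_cnj[OF fg assms(3)] ip_cnj[OF assms(1,3)] ip_cnj[OF assms(2,3)] ip_add[OF assms]
    by simp
qed

lemma ip_scale_right:
  assumes "f \<in> H" "g \<in> H" shows "ip g (fscale c f) = cnj c * ip g f"
proof -
  have cf: "fscale c f \<in> H" using assms cfun.subspace_scale[OF subspace] by blast
  show ?thesis
    unfolding ip_cnj[OF cf assms(2)] ip_cnj[OF assms] ip_scale[OF assms] by simp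
qed

lemma ip_cauchy_schwarz:
  assumes f: "f \<in> H" and g: "g \<in> H"
  shows "cmod (ip f g) \<le> ip_norm ip f * ip_norm ip g"
proof (cases "ip g g = 0")
  case True
  then have "fscale 0 g = g" using ip_definite[OF g] by (simp add: fscale_def fun_eq_iff)
  then have "ip f g = 0" using ip_scale_right[OF g f, of 0] by simp
  then show ?thesis using ip_norm_nonneg f g by simp
next
  case False
  define b where "b = Re (ip g g)"
  have gb: "ip g g = of_real b" unfolding b_def by (rule ip_self[OF g])
  have "b \<noteq> 0" using False gb by auto
  then have b: "b > 0" using ip_nonneg[OF g] unfolding b_def by linarith
  define c where "c = - (ip f g / of_real b)"
  let ?h = "fscale c g"
  have h: "?h \<in> H" using g cfun.subspace_scale[OF subspace] by blast
  have fh: "f + ?h \<in> H" using f h cfun.subspace_add[OF subspace] by blast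
  have gf: "ip g f = cnj (ip f g)" using ip_cnj[OF f g] .
  have "ip (f + ?h) (f + ?h) = ip f f + cnj c * ip f g + c * cnj (ip f g) + c * cnj c * of_real b"
    using f g h fh
    by (simp add: ip_add ip_add_right ip_scale ip_scale_right gf gb algebra_simps)
  also have "\<dots> = ip f f - ip f g * cnj (ip f g) / of_real b"
  proof -
    have cb: "c * of_real b = - ip f g" using b by (simp add: c_def)
    have "c * cnj c * of_real b = cnj c * (c * of_real b)" by simp
    also have "\<dots> = - (cnj c * ip f g)" unfolding cb by simp
    finally show ?thesis by (simp add: c_def)
  qed
  also have "\<dots> = of_real (Re (ip f f) - (cmod (ip f g))\<^sup>2 / b)"
    using ip_self[OF f, symmetric] by (simp add: complex_norm_square[symmetric])
  finally have "0 \<le> Re (ip f f) - (cmod (ip f g))\<^sup>2 / b"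
    using ip_nonneg[OF fh] by simp
  then have "(cmod (ip f g))\<^sup>2 \<le> Re (ip f f) * Re (ip g g)"
    using b by (simp add: field_simps b_def)
  then show ?thesis
    unfolding ip_norm_def real_sqrt_mult[symmetric] by (rule real_le_rsqrt)
qed

lemma ip_norm_triangle:
  assumes f: "f \<in> H" and g: "g \<in> H"
  shows "ip_norm ip (f + g) \<le> ip_norm ip f + ip_norm ip g"
proof -
  have fg: "f + g \<in> H" using f g cfun.subspace_add[OF subspace] by blast
  have sq: "(ip_norm ip h)\<^sup>2 = Re (ip h h)" if "h \<in> H" for h
    using ip_nonneg[OF that] by (simp add: ip_norm_def)
  have "Re (ip (f + g) (f + g)) = Re (ip f f) + Re (ip g g) + 2 * Re (ip f g)"
    using f g fg ip_cnj[OF f g] by (simp add: ip_add ip_add_right)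
  also have "\<dots> \<le> (ip_norm ip f + ip_norm ip g)\<^sup>2"
    using complex_Re_le_cmod[of "ip f g"] ip_cauchy_schwarz[OF f g]
    by (simp add: power2_sum sq f g)
  finally show ?thesis
    unfolding sq[OF fg, symmetric]
    by (rule power2_le_imp_le) (simp add: ip_norm_nonneg f g)
qed

lemma ip_norm_minus:
  assumes f: "f \<in> H" and g: "g \<in> H" shows "ip_norm ip (f - g) = ip_norm ip (g - f)"
proof -
  have d: "g - f \<in> H" using f g cfun.subspace_diff[OF subspace] by blast
  have s: "f - g = fscale (-1) (g - f)" by (simp add: fscale_def fun_eq_iff)
  have m: "fscale (-1) (g - f) \<in> H" using d cfun.subspace_scale[OF subspace] by blast
  have "ip (fscale (-1) (g - f)) (fscale (-1) (g - f)) = ip (g - f) (g - f)"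
    unfolding ip_scale[OF d m] ip_scale_right[OF d d] by simp
  then show ?thesis unfolding ip_norm_def s by (simp only:)
qed

sublocale Metric_space H "ip_dist H ip"
proof
  show "0 \<le> ip_dist H ip f g" for f g
    using ip_norm_nonneg[OF cfun.subspace_diff[OF subspace]] by (simp add: ip_dist_def)
  show "ip_dist H ip f g = ip_dist H ip g f" for f g
    using ip_norm_minus[of f g] by (simp add: ip_dist_def)
  show "ip_dist H ip f g = 0 \<longleftrightarrow> f = g" if "f \<in> H" "g \<in> H" for f g
  proof -
    have d: "f - g \<in> H" using that cfun.subspace_diff[OF subspace] by blast
    have "ip 0 0 = 0"
      using ip_scale[of 0 0 0] cfun.subspace_0[OF subspace] by (simp add: fscale_def zero_fun_def)
    moreover have "ip (f - g) (f - g) = 0" if "Re (ip (f - g) (f - g)) = 0"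
      using ip_self[OF d, unfolded that] by simp
    ultimately show ?thesis
      using that d ip_definite[OF d] by (auto simp: ip_dist_def ip_norm_def)
  qed
  show "ip_dist H ip f h \<le> ip_dist H ip f g + ip_dist H ip g h"
    if "f \<in> H" "g \<in> H" "h \<in> H" for f g h
    using that ip_norm_triangle[of "f - g" "g - h"] cfun.subspace_diff[OF subspace]
    by (simp add: ip_dist_def)
qed

end

locale hilbert_holomorphic_space = inner_product_function_space +
  assumes holomorphic: "H \<subseteq> hol_disc"
    and complete: mcomplete
    and inclusion_continuous: "continuous_map mtopology hol_disc_topology (\<lambda>f. f)"

definition disc_polynomials :: "(complex \<Rightarrow> complex) set" where
  "disc_polynomials = range (\<lambda>p :: complex poly. disc_ext (poly p))"

definition odd_on_disc :: "(complex \<Rightarrow> complex) \<Rightarrow> bool" where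
  "odd_on_disc f \<longleftrightarrow> (\<forall>z\<in>ball 0 1. f (- z) = - f z)"

definition taylor_sum :: "nat \<Rightarrow> (complex \<Rightarrow> complex) \<Rightarrow> (complex \<Rightarrow> complex)" where
  "taylor_sum n f = disc_ext (\<lambda>z. \<Sum>j\<le>n. fps_nth (fps_expansion f 0) j * z ^ j)"

definition linear_self_map ::
    "(complex \<Rightarrow> complex) set \<Rightarrow> ((complex \<Rightarrow> complex) \<Rightarrow> (complex \<Rightarrow> complex)) \<Rightarrow> bool" where
  "linear_self_map H T \<longleftrightarrow> T ` H \<subseteq> H \<and>
     (\<forall>f\<in>H. \<forall>g\<in>H. T (f + g) = T f + T g) \<and>
     (\<forall>a. \<forall>f\<in>H. T (fscale a f) = fscale a (T f))"

end

theory Submission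
  imports Defs
begin

text \<open>
  Any odd function in the space outside the closure of the odd polynomials works: its even Taylor
  coefficients vanish, so every combination of its Taylor partial sums is an odd polynomial.
\<close>

text \<open>Differentiating \<open>f (- w) = - f w\<close> \<open>j\<close> times at 0 gives
  \<open>(- 1) ^ j * (deriv ^^ j) f 0 = - (deriv ^^ j) f 0\<close>; for even \<open>j\<close> this
  forces the derivative to vanish.\<close>

lemma fps_expansion_odd_eq_0:
  assumes f: "f holomorphic_on ball 0 1" and odd: "odd_on_disc f" and j: "even j"
  shows "fps_nth (fps_expansion f 0) j = 0"
proof -
  have "(deriv ^^ j) (\<lambda>w. f (- 1 * w)) 0 = (- 1) ^ j * (deriv ^^ j) f (- 1 * 0)"
    by (rule higher_deriv_compose_linear[OF f open_ball[of 0 1] open_ball]) auto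
  \<comment> \<open>Oddness is known on the disc only, but derivatives at 0 depend only on values
    near 0.\<close>
  moreover have "\<forall>\<^sub>F w in nhds 0. f (- 1 * w) = - f w"
    using eventually_nhds_in_open[of "ball (0 :: complex) 1" 0] odd
    by (auto simp: odd_on_disc_def elim!: eventually_mono)
  then have "(deriv ^^ j) (\<lambda>w. f (- 1 * w)) 0 = (deriv ^^ j) (\<lambda>w. - f w) 0"
    by (rule higher_deriv_cong_ev) simp
  moreover have "(deriv ^^ j) (\<lambda>w. - f w) 0 = - (deriv ^^ j) f 0"
    by (rule higher_deriv_uminus[OF f open_ball]) simp
  ultimately have "(deriv ^^ j) f 0 = 0"
    using j by simp
  then show ?thesis
    by (simp add: fps_expansion_def)
qed

lemma taylor_sum_in_disc_polynomials: "taylor_sum n f \<in> disc_polynomials"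
proof -
  have "taylor_sum n f = disc_ext (poly (\<Sum>j\<le>n. monom (fps_nth (fps_expansion f 0) j) j))"
    by (simp add: taylor_sum_def poly_sum poly_monom disc_ext_def fun_eq_iff)
  then show ?thesis
    by (simp add: disc_polynomials_def)
qed

text \<open>Works term by term: for odd \<open>j\<close> the sign comes out of
  \<open>(- z) ^ j\<close>, for even \<open>j\<close> the coefficient is zero.\<close>

lemma odd_taylor_sum:
  assumes "f holomorphic_on ball 0 1" "odd_on_disc f"
  shows "odd_on_disc (taylor_sum n f)"
proof -
  have "fps_nth (fps_expansion f 0) j * (- z) ^ j = - (fps_nth (fps_expansion f 0) j * z ^ j)" for j z
    using fps_expansion_odd_eq_0[OF assms, of j] by (cases "even j") auto
  then show ?thesis
    by (simp add: odd_on_disc_def taylor_sum_def disc_ext_def sum_negf)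
qed

lemma subspace_odd_disc_polynomials:
  "cfun.subspace {p \<in> disc_polynomials. odd_on_disc p}"
proof (rule cfun.subspaceI)
  have "(0 :: complex \<Rightarrow> complex) = disc_ext (poly 0)"
    by (simp add: disc_ext_def fun_eq_iff)
  then show "0 \<in> {p \<in> disc_polynomials. odd_on_disc p}"
    by (auto simp: disc_polynomials_def odd_on_disc_def)
next
  fix p q
  assume pq: "p \<in> {p \<in> disc_polynomials. odd_on_disc p}"
    "q \<in> {p \<in> disc_polynomials. odd_on_disc p}"
  then obtain a b where ab: "p = disc_ext (poly a)" "q = disc_ext (poly b)"
    by (auto simp: disc_polynomials_def)
  have "p + q = disc_ext (poly (a + b))"
    by (simp add: ab disc_ext_def fun_eq_iff)
  then have "p + q \<in> disc_polynomials"
    by (simp add: disc_polynomials_def)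
  then show "p + q \<in> {p \<in> disc_polynomials. odd_on_disc p}"
    using pq by (simp add: odd_on_disc_def)
next
  fix c p assume p: "p \<in> {p \<in> disc_polynomials. odd_on_disc p}"
  then obtain a where a: "p = disc_ext (poly a)"
    by (auto simp: disc_polynomials_def)
  have "fscale c p = disc_ext (poly (smult c a))"
    by (simp add: a disc_ext_def fscale_def fun_eq_iff)
  then have "fscale c p \<in> disc_polynomials"
    by (simp add: disc_polynomials_def)
  then show "fscale c p \<in> {p \<in> disc_polynomials. odd_on_disc p}"
    using p by (simp add: odd_on_disc_def fscale_def)
qed

text \<open>The generators are odd polynomials, and these form a subspace, so linear combinations
  cannot leave it.\<close>

lemma span_taylor_sum_odd:
  assumes "f holomorphic_on ball 0 1" "odd_on_disc f"
  shows "cfun.span (range (\<lambda>n. taylor_sum n f)) \<subseteq> {p \<in> disc_polynomials. odd_on_disc p}"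
  using taylor_sum_in_disc_polynomials odd_taylor_sum[OF assms]
  by (intro cfun.span_minimal subspace_odd_disc_polynomials) auto

text \<open>Links norm convergence to the topological closure; with \<open>S\<close> the span of the
  Taylor sums, it reduces the claim about the maps \<open>T n\<close> to the claim about the
  span.\<close>

lemma (in inner_product_function_space) ip_norm_limit_in_closure_of:
  assumes f: "f \<in> H" and g: "\<And>n. g n \<in> H" "\<And>n. g n \<in> S"
    and lim: "(\<lambda>n. ip_norm ip (g n - f)) \<longlonglongrightarrow> 0"
  shows "f \<in> mtopology closure_of S"
  unfolding metric_closure_of
proof (intro CollectI conjI allI impI f)
  fix r :: real assume "r > 0"
  then obtain n where "ip_norm ip (g n - f) < r"
    using order_tendstoD(2)[OF lim] eventually_happens[of _ sequentially] by fastforce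
  \<comment> \<open>The ball contains only points of \<open>H\<close>, where \<open>ip_dist\<close>
    is the norm distance and not its default 0; \<open>ip_norm_minus\<close> swaps the difference,
    since the ball is centred at \<open>f\<close>.\<close>
  then have "g n \<in> mball f r"
    using f g(1)[of n] ip_norm_minus[of f "g n"] by (simp add: ip_dist_def)
  then show "\<exists>y\<in>S. y \<in> mball f r"
    using g(2) by blast
qed

theorem corollary1p2:
  fixes H :: "(complex \<Rightarrow> complex) set"
    and ip :: "(complex \<Rightarrow> complex) \<Rightarrow> (complex \<Rightarrow> complex) \<Rightarrow> complex"
  assumes "hilbert_holomorphic_space H ip"
    and "disc_polynomials \<subseteq> H"
    and "ip_topology H ip closure_of disc_polynomials = H"
    and "\<not> {f \<in> H. odd_on_disc f} \<subseteq>
           ip_topology H ip closure_of {p \<in> disc_polynomials. odd_on_disc p}"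
  shows "\<exists>f\<in>H.
           f \<notin> ip_topology H ip closure_of (cfun.span (range (\<lambda>n. taylor_sum n f))) \<and>
           \<not> (\<exists>(c :: nat \<Rightarrow> nat \<Rightarrow> complex) T.
                (\<forall>n. linear_self_map H (T n) \<and>
                     (\<forall>g\<in>H. T n g = (\<Sum>k\<le>n. fscale (c n k) (taylor_sum k g)))) \<and>
                (\<lambda>n. ip_norm ip (T n f - f)) \<longlonglongrightarrow> 0)"
proof -
  interpret hilbert_holomorphic_space H ip by fact
  obtain f where f: "f \<in> H" "odd_on_disc f"
    and notin: "f \<notin> mtopology closure_of {p \<in> disc_polynomials. odd_on_disc p}"
    using assms(4) by blast
  have "f holomorphic_on ball 0 1"
    using f(1) holomorphic by (auto simp: hol_disc_def)
  \<comment> \<open>Closure is monotone, so avoiding the closure of all odd polynomials means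
    avoiding that of the smaller span.\<close>
  from closure_of_mono[OF span_taylor_sum_odd[OF this f(2)], of mtopology] notin
  have out: "f \<notin> mtopology closure_of (cfun.span (range (\<lambda>n. taylor_sum n f)))"
    by blast
  \<comment> \<open>At \<open>g = f\<close> the formula puts every \<open>T n f\<close> in the span
    of the Taylor sums of \<open>f\<close>, so convergence to \<open>f\<close> would place
    \<open>f\<close> in the closure that it avoids.\<close>
  have False
    if T: "\<forall>n. linear_self_map H (T n) \<and>
             (\<forall>g\<in>H. T n g = (\<Sum>k\<le>n. fscale (c n k) (taylor_sum k g)))"
      and lim: "(\<lambda>n. ip_norm ip (T n f - f)) \<longlonglongrightarrow> 0"
    for c :: "nat \<Rightarrow> nat \<Rightarrow> complex" and T
  proof -
    have "T n f \<in> H" for n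
      using T f(1) unfolding linear_self_map_def by blast
    moreover have "T n f \<in> cfun.span (range (\<lambda>n. taylor_sum n f))" for n
      using T f(1) by (simp add: cfun.span_sum cfun.span_scale cfun.span_base)
    ultimately show False
      using ip_norm_limit_in_closure_of[OF f(1) _ _ lim] out by blast
  qed
  with f(1) out show ?thesis
    by blast
qed

end
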